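(* Let $N\ge2$ and let $\{X_n^{(N)}\}$ be the truncated Lamperti chain on $\{1,\dots,N\}$ with transition matrix $P_{(N)}(i,j)=F_{(N)}(j)^i-F_{(N)}(j-1)^i$. For $i\in\{1,\dots,N-1\}$ let $\tau_{i,N}=\inf(n\ge1:X_n^{(N)}=N\mid X_0^{(N)}=i)$. Let $Z_{(N-1)}$ be a random variable distributed according to the quasi-stationary distribution $\mathbf{\mu}_{(N-1)}$ on $\{1,\dots,N-1\}$, and let $$\rho_N=\mathbf{E}\left(z^{Z_{(N-1)}}\right)\Big|_{z=F_{(N)}(N-1)}=\sum_{1\le j<N}F_{(N)}(N-1)^j\mu_{(N-1)}(j).$$ Then, independently of $i\in\{1,\dots,N-1\}$, $$\lim_{n\to\infty}-\frac1n\log\mathbf{P}(\tau_{i,N}>n)=-\log\mathbf{E}\left(z^{Z_{(N-1)}}\right)\Big|_{z=F_{(N)}(N-1)}=-\log\rho_N .$$ Equivalently, $\rho_N$ is the rate of decay of $\mathbf{P}(\tau_{i,N}>n)$.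
   Context: Truncated Lamperti chain: let $\mathbf{\pi}$ be the invariant probability measure of a positive recurrent Lamperti chain on $\{1,2,\dots\}$, i.e. of a Markov chain with transition matrix $P(i,j)=F(j)^i-F(j-1)^i$, where $F$ is the distribution function of a random variable $\nu$ with $\mathbf{P}(\nu=j)>0$ for all $j\ge1$, and put $\pi_{(N)}(k)=\pi(k)/\sum_{l=1}^N\pi(l)$, $k=1,\dots,N$. Then $F_{(N)}(j)\in[0,1]$ is determined by $\sum_{k=1}^{j}\pi_{(N)}(k)=\sum_{k=1}^N\pi_{(N)}(k)F_{(N)}(j)^k$, $j=1,\dots,N$, $F_{(N)}(0)=0$. The matrix $P_{(N-1)}$ is the substochastic $(N-1)\times(N-1)$ matrix obtained from $P_{(N)}$ by removing its $N$-th row and $N$-th column. The quasi-stationary distribution $\mathbf{\mu}_{(N-1)}$ is the left eigenvector of $P_{(N-1)}$ with positive entries summing to $1$ associated with its dominant (Perron–Frobenius) eigenvalue; equivalently $\mu_{(N-1)}(j)=\lim_{n\to\infty}\mathbf{P}_i(X_n^{(N)}=j\mid\tau_{i,N}>n)$. *)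

theory Defs
  imports
    "HOL-Probability.Probability"
    "HOL-Library.Extended_Nat"
    "Jordan_Normal_Form.Spectral_Radius"
begin

subsection \<open>Markov chains on a countable set of natural numbers\<close>

text \<open>Transition matrices are functions of (current state, next state). The values of the history
  \<open>x\<close> outside the times \<open>0, ..., n\<close> are irrelevant.\<close>

definition markov_chain ::
  "'a measure \<Rightarrow> nat set \<Rightarrow> (nat \<Rightarrow> nat \<Rightarrow> real) \<Rightarrow> (nat \<Rightarrow> 'a \<Rightarrow> nat) \<Rightarrow> bool" where
  "markov_chain M S P X \<longleftrightarrow>
     prob_space M \<and>
     (\<forall>n. X n \<in> M \<rightarrow>\<^sub>M count_space S) \<and>
     (\<forall>n x. \<forall>y\<in>S.
        measure M {\<omega> \<in> space M. \<forall>k\<le>n. X k \<omega> = x k} > 0 \<longrightarrow>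
        cond_prob M (\<lambda>\<omega>. X (Suc n) \<omega> = y) (\<lambda>\<omega>. \<forall>k\<le>n. X k \<omega> = x k) = P (x n) y)"

text \<open>The infimum is over strictly positive times; it is \<open>\<infinity>\<close> if the state is never hit.\<close>

definition hitting_time :: "(nat \<Rightarrow> 'a \<Rightarrow> nat) \<Rightarrow> nat \<Rightarrow> 'a \<Rightarrow> enat" where
  "hitting_time X s \<omega> = Inf (enat ` {n. 1 \<le> n \<and> X n \<omega> = s})"

definition survival_prob :: "'a measure \<Rightarrow> (nat \<Rightarrow> 'a \<Rightarrow> nat) \<Rightarrow> nat \<Rightarrow> nat \<Rightarrow> real" where
  "survival_prob M X s n = measure M {\<omega> \<in> space M. hitting_time X s \<omega> > enat n}"

text \<open>\<open>first_passage P S n i j\<close> is the probability that the chain with transition matrix \<open>P\<close>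
  on the state space \<open>S\<close>, started at \<open>i\<close>, visits \<open>j\<close> for the first time (after time 0) at
  time \<open>Suc n\<close>; note the shift of the time index.\<close>

primrec first_passage ::
  "(nat \<Rightarrow> nat \<Rightarrow> real) \<Rightarrow> nat set \<Rightarrow> nat \<Rightarrow> nat \<Rightarrow> nat \<Rightarrow> real" where
  "first_passage P S 0 i j = P i j"
| "first_passage P S (Suc n) i j = (\<Sum>\<^sub>\<infinity>k\<in>S - {j}. P i k * first_passage P S n k j)"

text \<open>Return is almost sure and the mean return time is finite, for every state.\<close>

definition positive_recurrent :: "(nat \<Rightarrow> nat \<Rightarrow> real) \<Rightarrow> nat set \<Rightarrow> bool" where
  "positive_recurrent P S \<longleftrightarrow>
     (\<forall>i\<in>S. (\<lambda>n. first_passage P S n i i) sums 1 \<and>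
             summable (\<lambda>n. real (Suc n) * first_passage P S n i i))"

definition invariant_probability ::
  "(nat \<Rightarrow> nat \<Rightarrow> real) \<Rightarrow> nat set \<Rightarrow> nat pmf \<Rightarrow> bool" where
  "invariant_probability P S \<pi> \<longleftrightarrow>
     set_pmf \<pi> \<subseteq> S \<and> (\<forall>j\<in>S. ((\<lambda>i. pmf \<pi> i * P i j) has_sum pmf \<pi> j) S)"


subsection \<open>Lamperti chains and their truncation\<close>

definition dist_fun :: "nat pmf \<Rightarrow> nat \<Rightarrow> real" where
  "dist_fun \<nu> j = measure_pmf.prob \<nu> {..j}"

text \<open>Only used for states \<open>i, j \<ge> 1\<close>, so that \<open>j - 1\<close> is not affected by truncation.\<close>

definition lamperti_matrix :: "(nat \<Rightarrow> real) \<Rightarrow> nat \<Rightarrow> nat \<Rightarrow> real" where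
  "lamperti_matrix F i j = F j ^ i - F (j - 1) ^ i"

definition trunc_pi :: "nat pmf \<Rightarrow> nat \<Rightarrow> nat \<Rightarrow> real" where
  "trunc_pi \<pi> N k = pmf \<pi> k / (\<Sum>l=1..N. pmf \<pi> l)"

definition trunc_F :: "nat pmf \<Rightarrow> nat \<Rightarrow> nat \<Rightarrow> real" where
  "trunc_F \<pi> N j =
     (if j = 0 then 0
      else (THE x. 0 \<le> x \<and> x \<le> 1 \<and>
                   (\<Sum>k=1..j. trunc_pi \<pi> N k) = (\<Sum>k=1..N. trunc_pi \<pi> N k * x ^ k)))"

text \<open>The description defining \<open>trunc_F\<close> is proper.\<close>

lemma trunc_F_ex1:
  assumes pos: "\<And>k. 1 \<le> k \<Longrightarrow> k \<le> N \<Longrightarrow> pmf \<pi> k > 0" and j: "1 \<le> j" "j \<le> N"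
  shows "\<exists>!x. 0 \<le> x \<and> x \<le> 1 \<and>
                   (\<Sum>k=1..j. trunc_pi \<pi> N k) = (\<Sum>k=1..N. trunc_pi \<pi> N k * x ^ k)"
proof -
  define g where "g x = (\<Sum>k=1..N. trunc_pi \<pi> N k * x ^ k)" for x :: real
  define c where "c = (\<Sum>k=1..j. trunc_pi \<pi> N k)"
  have S: "(\<Sum>l=1..N. pmf \<pi> l) > 0"
    using j pos by (intro sum_pos) auto
  have tpos: "trunc_pi \<pi> N k > 0" if "1 \<le> k" "k \<le> N" for k
    using pos[OF that] S by (simp add: trunc_pi_def)
  have g0: "g 0 = 0" unfolding g_def by (intro sum.neutral) auto
  have g1: "g 1 = 1"
    using S by (simp add: g_def trunc_pi_def flip: sum_divide_distrib)
  have c0: "0 \<le> c"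
    unfolding c_def by (intro sum_nonneg) (simp add: trunc_pi_def sum_nonneg)
  have "c \<le> (\<Sum>k=1..N. trunc_pi \<pi> N k)"
    unfolding c_def using j by (intro sum_mono2) (auto simp: trunc_pi_def sum_nonneg)
  then have c1: "c \<le> g 1" by (simp add: g_def)
  have cont: "continuous_on {0..1} g" unfolding g_def by (intro continuous_intros)
  have "\<exists>x. 0 \<le> x \<and> x \<le> 1 \<and> g x = c"
    by (rule IVT') (simp_all only: g0 c0 c1 cont zero_le_one)
  then obtain x where x: "0 \<le> x" "x \<le> 1" "g x = c" by blast
  have less: "g u < g v" if "0 \<le> u" "u < v" for u v
    unfolding g_def
  proof (intro sum_strict_mono)
    fix k assume "k \<in> {1..N}"
    then show "trunc_pi \<pi> N k * u ^ k < trunc_pi \<pi> N k * v ^ k"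
      using that tpos[of k] by (intro mult_strict_left_mono power_strict_mono) auto
  qed (use j in auto)
  have uniq: "y = x" if "0 \<le> y" "g y = c" for y
  proof (rule ccontr)
    assume "y \<noteq> x"
    then consider "x < y" | "y < x" by linarith
    then show False
      by cases (use less[of x y] less[of y x] x(1,3) that in simp_all)
  qed
  have "\<exists>!x. 0 \<le> x \<and> x \<le> 1 \<and> c = g x"
    by (rule ex1I[of _ x]) (use x uniq in blast)+
  then show ?thesis unfolding g_def c_def .
qed

definition trunc_matrix :: "nat pmf \<Rightarrow> nat \<Rightarrow> nat \<Rightarrow> nat \<Rightarrow> real" where
  "trunc_matrix \<pi> N = lamperti_matrix (trunc_F \<pi> N)"


subsection \<open>Quasi-stationary distribution\<close>

text \<open>Matrix and vector indices start at 0, so state \<open>i\<close> has index \<open>i - 1\<close>.\<close>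

definition trunc_mat :: "nat pmf \<Rightarrow> nat \<Rightarrow> real mat" where
  "trunc_mat \<pi> N = Matrix.mat N N (\<lambda>(i, j). trunc_matrix \<pi> N (Suc i) (Suc j))"

definition substoch_mat :: "nat pmf \<Rightarrow> nat \<Rightarrow> real mat" where
  "substoch_mat \<pi> N = mat_delete (trunc_mat \<pi> N) (N - 1) (N - 1)"

text \<open>The dominant (Perron--Frobenius) eigenvalue of a nonnegative matrix is its spectral radius,
  taken over all complex eigenvalues. A left eigenvector is an eigenvector of the transpose.\<close>

definition quasi_stationary :: "nat pmf \<Rightarrow> nat \<Rightarrow> nat pmf \<Rightarrow> bool" where
  "quasi_stationary \<pi> N \<mu> \<longleftrightarrow>
     set_pmf \<mu> = {1..N - 1} \<and>
     eigenvector (transpose_mat (substoch_mat \<pi> N))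
       (Matrix.vec (N - 1) (\<lambda>j. pmf \<mu> (Suc j)))
       (spectral_radius (map_mat complex_of_real (substoch_mat \<pi> N)))"

definition rho :: "nat pmf \<Rightarrow> nat \<Rightarrow> nat pmf \<Rightarrow> real" where
  "rho \<pi> N \<mu> = (\<Sum>j\<in>{1..<N}. trunc_F \<pi> N (N - 1) ^ j * pmf \<mu> j)"

end

(* By the Markov property the survival probabilities s_n(i) = P_i(tau > n) satisfy
   s_{n+1}(i) = sum_{k < N} P(i,k) s_n(k). Summing the eigenvector equation over the states
   and using that the rows of the truncated matrix telescope to F(N-1)^i shows that the
   Perron-Frobenius eigenvalue is rho. Pairing s_n with the quasi-stationary distribution
   gives sum_i mu(i) s_n(i) = rho^n, and strict positivity of P upgrades this to two-sided bounds
   a rho^n <= s_n(i) <= b rho^n. *)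

theory Submission
  imports Defs
begin

subsection \<open>Survival probabilities of a Markov chain\<close>

text \<open>This is the n-th power of the restriction of \<open>P\<close> to \<open>T\<close>,
  applied to the constant vector 1. The starting state may lie outside \<open>T\<close>, since only
  the times 1 to n are constrained.\<close>

primrec avoid_prob :: "(nat \<Rightarrow> nat \<Rightarrow> real) \<Rightarrow> nat set \<Rightarrow> nat \<Rightarrow> nat \<Rightarrow> real" where
  "avoid_prob P T 0 i = 1"
| "avoid_prob P T (Suc n) i = (\<Sum>k\<in>T. P i k * avoid_prob P T n k)"

text \<open>The strict inequality is rewritten as
  \<open>enat (Suc n) \<le> hitting_time X s \<omega>\<close>, because lower bounds pass through an
  infimum; the value infinity is thereby covered too.\<close>

lemma less_hitting_time_iff:
  "enat n < hitting_time X s \<omega> \<longleftrightarrow> (\<forall>k\<in>{0<..n}. X k \<omega> \<noteq> s)"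
  unfolding hitting_time_def by (auto simp: le_Inf_iff not_le not_less Suc_le_eq simp flip: Suc_ile_eq)

text \<open>The Markov property in product form. It extends to histories of probability zero, where
  no conditional probability is prescribed: the longer history is a smaller event, so both sides
  vanish.\<close>

lemma markov_chain_history_step:
  assumes mc: "markov_chain M S P X" and y: "y \<in> S"
  shows "measure M {\<omega> \<in> space M. \<forall>k\<le>Suc p. X k \<omega> = (x(Suc p := y)) k}
       = measure M {\<omega> \<in> space M. \<forall>k\<le>p. X k \<omega> = x k} * P (x p) y"
proof -
  interpret prob_space M using mc by (simp add: markov_chain_def)
  have [measurable]: "X k \<in> M \<rightarrow>\<^sub>M count_space S" for k
    using mc by (simp add: markov_chain_def)
  have eq: "{\<omega> \<in> space M. \<forall>k\<le>Suc p. X k \<omega> = (x(Suc p := y)) k}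
      = {\<omega> \<in> space M. X (Suc p) \<omega> = y \<and> (\<forall>k\<le>p. X k \<omega> = x k)}"
    by (auto simp: le_Suc_eq)
  show ?thesis
  proof (cases "measure M {\<omega> \<in> space M. \<forall>k\<le>p. X k \<omega> = x k} = 0")
    case True
    have "measure M {\<omega> \<in> space M. X (Suc p) \<omega> = y \<and> (\<forall>k\<le>p. X k \<omega> = x k)}
        \<le> measure M {\<omega> \<in> space M. \<forall>k\<le>p. X k \<omega> = x k}"
      by (intro finite_measure_mono) auto
    then show ?thesis
      using True measure_nonneg[of M "{\<omega> \<in> space M. X (Suc p) \<omega> = y \<and> (\<forall>k\<le>p. X k \<omega> = x k)}"]
      unfolding eq by (simp add: measure_le_0_iff)
  next
    case False
    then have pos: "measure M {\<omega> \<in> space M. \<forall>k\<le>p. X k \<omega> = x k} > 0"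
      by (simp add: less_le)
    then have "cond_prob M (\<lambda>\<omega>. X (Suc p) \<omega> = y) (\<lambda>\<omega>. \<forall>k\<le>p. X k \<omega> = x k) = P (x p) y"
      using mc y unfolding markov_chain_def by blast
    then show ?thesis
      using pos unfolding eq cond_prob_def by (simp add: field_simps)
  qed
qed

text \<open>The Markov property is available only for conditioning on a full history, so the
  induction on \<open>n\<close> keeps \<open>p\<close> and \<open>x\<close> general: each step
  lengthens the history by one state and restarts from time \<open>Suc p\<close>.\<close>

lemma markov_chain_avoid:
  assumes mc: "markov_chain M S P X" and fin: "finite S"
  shows "measure M {\<omega> \<in> space M. (\<forall>k\<le>p. X k \<omega> = x k) \<and> (\<forall>k\<in>{p<..p + n}. X k \<omega> \<noteq> s)}
       = measure M {\<omega> \<in> space M. \<forall>k\<le>p. X k \<omega> = x k} * avoid_prob P (S - {s}) n (x p)"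
proof (induction n arbitrary: p x)
  case 0
  then show ?case by simp
next
  case (Suc n)
  interpret prob_space M using mc by (simp add: markov_chain_def)
  have meas[measurable]: "X k \<in> M \<rightarrow>\<^sub>M count_space S" for k
    using mc by (simp add: markov_chain_def)
  \<comment> \<open>The event is split by the state y at time \<open>Suc p\<close>. Recording y in
    the history makes each piece an instance of the induction hypothesis.\<close>
  define E where "E y = {\<omega> \<in> space M. (\<forall>k\<le>Suc p. X k \<omega> = (x(Suc p := y)) k) \<and>
      (\<forall>k\<in>{Suc p<..Suc p + n}. X k \<omega> \<noteq> s)}" for y
  have "{p<..p + Suc n} = insert (Suc p) {Suc p<..Suc p + n}" by auto
  moreover have "X (Suc p) \<omega> \<in> S" if "\<omega> \<in> space M" for \<omega>
    using measurable_space[OF meas that] by simp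
  ultimately have "{\<omega> \<in> space M. (\<forall>k\<le>p. X k \<omega> = x k) \<and> (\<forall>k\<in>{p<..p + Suc n}. X k \<omega> \<noteq> s)}
      = (\<Union>y\<in>S - {s}. E y)"
    unfolding E_def by (auto simp: le_Suc_eq)
  moreover have "measure M (\<Union>y\<in>S - {s}. E y) = (\<Sum>y\<in>S - {s}. measure M (E y))"
  proof (rule finite_measure_finite_Union)
    show "E ` (S - {s}) \<subseteq> sets M" unfolding E_def by (auto, measurable)
    show "disjoint_family_on E (S - {s})"
      unfolding disjoint_family_on_def E_def by force
  qed (use fin in auto)
  moreover have "measure M (E y) = measure M {\<omega> \<in> space M. \<forall>k\<le>p. X k \<omega> = x k}
      * (P (x p) y * avoid_prob P (S - {s}) n y)" if "y \<in> S" for y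
    unfolding E_def Suc.IH[of "Suc p" "x(Suc p := y)"] markov_chain_history_step[OF mc that]
    by simp
  ultimately show ?case
    by (simp add: sum_distrib_left)
qed

lemma survival_prob_eq:
  assumes mc: "markov_chain M S P X" and fin: "finite S" and start: "AE \<omega> in M. X 0 \<omega> = i"
  shows "survival_prob M X s n = avoid_prob P (S - {s}) n i"
proof -
  interpret prob_space M using mc by (simp add: markov_chain_def)
  have [measurable]: "X k \<in> M \<rightarrow>\<^sub>M count_space S" for k
    using mc by (simp add: markov_chain_def)
  have "survival_prob M X s n
      = measure M {\<omega> \<in> space M. (\<forall>k\<le>0. X k \<omega> = i) \<and> (\<forall>k\<in>{0<..0 + n}. X k \<omega> \<noteq> s)}"
    unfolding survival_prob_def less_hitting_time_iff
    \<comment> \<open>The condition on the initial state holds almost surely, so inserting it as a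
      history of length one does not change the measure.\<close>
    by (rule finite_measure_eq_AE) (use start in auto)
  also have "\<dots> = measure M {\<omega> \<in> space M. X 0 \<omega> = i} * avoid_prob P (S - {s}) n i"
    using markov_chain_avoid[OF mc fin, of 0 "\<lambda>_. i" n s] by simp
  also have "measure M {\<omega> \<in> space M. X 0 \<omega> = i} = 1"
    using start by (subst prob_eq_1) auto
  finally show ?thesis by simp
qed

subsection \<open>Geometric decay from a positive left eigenvector\<close>

text \<open>A left eigenvector moves across the matrix power: each application of \<open>P\<close>
  restricted to \<open>T\<close> contributes one factor \<open>r\<close>, and pairing
  \<open>u\<close> with the constant 1 leaves \<open>sum u T\<close>.\<close>

lemma avoid_prob_pairing:
  assumes fin: "finite T"
    and eig: "\<And>j. j \<in> T \<Longrightarrow> (\<Sum>i\<in>T. u i * P i j) = r * u j"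
  shows "(\<Sum>i\<in>T. u i * avoid_prob P T n i) = r ^ n * sum u T"
proof (induction n)
  case (Suc n)
  have "(\<Sum>i\<in>T. u i * avoid_prob P T (Suc n) i)
      = (\<Sum>i\<in>T. \<Sum>k\<in>T. u i * P i k * avoid_prob P T n k)"
    by (simp add: sum_distrib_left mult.assoc)
  also have "\<dots> = (\<Sum>k\<in>T. (\<Sum>i\<in>T. u i * P i k) * avoid_prob P T n k)"
    by (subst sum.swap) (simp add: sum_distrib_right)
  also have "\<dots> = (\<Sum>k\<in>T. r * (u k * avoid_prob P T n k))"
    by (intro sum.cong) (simp_all add: eig mult.assoc)
  finally show ?case by (simp add: Suc.IH flip: sum_distrib_left)
qed simp

lemma avoid_prob_pos:
  assumes "finite T" "\<And>i k. i \<in> T \<Longrightarrow> k \<in> T \<Longrightarrow> P i k > 0" "i \<in> T"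
  shows "avoid_prob P T n i > 0"
  using assms(3)
  by (induction n arbitrary: i) (auto intro!: sum_pos mult_pos_pos assms)

text \<open>Upper bound: \<open>u i * avoid_prob P T n i\<close> is one term of the nonnegative
  pairing sum. Lower bound: the positive row \<open>P i\<close> dominates a multiple of
  \<open>u\<close>, so after one step the pairing identity applies.\<close>

lemma avoid_prob_geometric:
  assumes fin: "finite T" and pos: "\<And>i k. i \<in> T \<Longrightarrow> k \<in> T \<Longrightarrow> P i k > 0"
    and eig: "\<And>j. j \<in> T \<Longrightarrow> (\<Sum>i\<in>T. u i * P i j) = r * u j"
    and u: "\<And>j. j \<in> T \<Longrightarrow> u j > 0" and r: "r > 0" and i: "i \<in> T"
  obtains a b where "a > 0" "b > 0"
    "\<And>n. a * r ^ n \<le> avoid_prob P T n i" "\<And>n. avoid_prob P T n i \<le> b * r ^ n"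
proof -
  let ?s = "avoid_prob P T" and ?c = "Min ((\<lambda>k. P i k / u k) ` T)"
  have U: "sum u T > 0" using fin i u by (intro sum_pos) auto
  have s0: "?s n k \<ge> 0" if "k \<in> T" for n k
    using avoid_prob_pos[OF fin pos that] by (simp add: less_imp_le)
  have c: "?c > 0" using fin i pos u by (subst Min_gr_iff) auto
  have cle: "?c * u k \<le> P i k" if "k \<in> T" for k
  proof -
    have "?c \<le> P i k / u k" using fin that by (intro Min_le) auto
    then show ?thesis using u[OF that] by (simp add: field_simps)
  qed
  \<comment> \<open>The argument 1 serves n = 0, where the survival probability is 1. The other one
    divides by \<open>r\<close> because the first step is spent on comparing row \<open>i\<close>
    with \<open>u\<close>, leaving only n - 1 factors of \<open>r\<close>.\<close>
  define a where "a = min 1 (?c * sum u T / r)"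
  have a0: "a > 0" using c U r by (simp add: a_def)
  have lower: "a * r ^ n \<le> ?s n i" for n
  proof (cases n)
    case (Suc m)
    have "a * r ^ n \<le> (?c * sum u T / r) * r ^ n"
      using r by (intro mult_right_mono) (auto simp: a_def)
    also have "\<dots> = ?c * (\<Sum>k\<in>T. u k * ?s m k)"
      using r by (simp add: Suc avoid_prob_pairing[OF fin eig])
    also have "\<dots> = (\<Sum>k\<in>T. ?c * u k * ?s m k)"
      by (simp add: sum_distrib_left mult.assoc)
    also have "\<dots> \<le> (\<Sum>k\<in>T. P i k * ?s m k)"
      by (intro sum_mono mult_right_mono cle s0)
    finally show ?thesis by (simp add: Suc)
  qed (simp add: a_def)
  have upper: "?s n i \<le> sum u T / u i * r ^ n" for n
  proof -
    have "u i * ?s n i \<le> (\<Sum>k\<in>T. u k * ?s n k)"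
      using fin i u s0 by (intro member_le_sum) (auto simp: less_imp_le)
    then show ?thesis
      using u[OF i] by (simp add: avoid_prob_pairing[OF fin eig] field_simps)
  qed
  show ?thesis
    by (rule that[of a "sum u T / u i"]) (use a0 lower upper U u[OF i] in auto)
qed

lemma geometric_decay_rate:
  fixes s :: "nat \<Rightarrow> real"
  assumes "a > 0" "b > 0" "r > 0"
    and lower: "\<And>n. a * r ^ n \<le> s n" and upper: "\<And>n. s n \<le> b * r ^ n"
  shows "(\<lambda>n. (1 / real n) * ln (s n)) \<longlonglongrightarrow> ln r"
proof (rule tendsto_sandwich)
  have s: "s n > 0" for n
    using lower[of n] assms(1,3) by (meson mult_pos_pos zero_less_power less_le_trans)
  have *: "ln (c * r ^ n) / real n = ln c / real n + ln r" if "c > 0" "n > 0" for c n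
    using that assms(3) by (simp add: ln_mult ln_realpow field_simps)
  show "\<forall>\<^sub>F n in sequentially. ln a / real n + ln r \<le> (1 / real n) * ln (s n)"
    using eventually_gt_at_top[of 0]
  proof eventually_elim
    case (elim n)
    have "ln (a * r ^ n) \<le> ln (s n)"
      using lower[of n] s[of n] assms by (subst ln_le_cancel_iff) auto
    then show ?case using *[of a n] elim assms by (simp add: divide_right_mono flip: *)
  qed
  show "\<forall>\<^sub>F n in sequentially. (1 / real n) * ln (s n) \<le> ln b / real n + ln r"
    using eventually_gt_at_top[of 0]
  proof eventually_elim
    case (elim n)
    have "ln (s n) \<le> ln (b * r ^ n)"
      using upper[of n] s[of n] assms by (subst ln_le_cancel_iff) auto
    then show ?case using *[of b n] elim assms by (simp add: divide_right_mono flip: *)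
  qed
  show "(\<lambda>n. ln a / real n + ln r) \<longlonglongrightarrow> ln r" "(\<lambda>n. ln b / real n + ln r) \<longlonglongrightarrow> ln r"
    by real_asymp+
qed

text \<open>Exponentiating the logarithmic rate gives the root form. The two sequences agree only
  for n > 0, since \<open>root 0\<close> is 0 by convention.\<close>

lemma root_decay_rate:
  fixes s :: "nat \<Rightarrow> real"
  assumes "\<And>n. s n > 0" "r > 0" "(\<lambda>n. (1 / real n) * ln (s n)) \<longlonglongrightarrow> ln r"
  shows "(\<lambda>n. root n (s n)) \<longlonglongrightarrow> r"
proof -
  have "(\<lambda>n. exp ((1 / real n) * ln (s n))) \<longlonglongrightarrow> exp (ln r)"
    by (intro tendsto_exp assms)
  moreover have "\<forall>\<^sub>F n in sequentially. exp ((1 / real n) * ln (s n)) = root n (s n)"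
    using eventually_gt_at_top[of 0]
  proof eventually_elim
    case (elim n)
    have "s n \<noteq> 0" using assms(1)[of n] by simp
    then show ?case
      using root_powr_inverse[OF elim, of "s n"] assms(1)[of n] by (simp add: powr_def)
  qed
  ultimately show ?thesis
    using assms(2) by (simp add: tendsto_cong)
qed

subsection \<open>The truncated Lamperti chain\<close>

text \<open>The sum telescopes; \<open>i \<ge> 1\<close> is what makes the bottom term
  \<open>F 0 ^ i\<close> vanish, as \<open>0 ^ 0 = 1\<close>.\<close>

lemma sum_lamperti_matrix:
  assumes "F 0 = 0" "i \<ge> 1"
  shows "(\<Sum>j=1..m. lamperti_matrix F i j) = F m ^ i"
  using assms by (induction m) (auto simp: lamperti_matrix_def power_0_left)

lemma lamperti_matrix_pos:
  assumes "0 \<le> F (j - 1)" "F (j - 1) < F j" "i \<ge> 1"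
  shows "lamperti_matrix F i j > 0"
  using assms by (auto simp: lamperti_matrix_def intro!: power_strict_mono)

lemma dist_fun_step_less:
  assumes "set_pmf \<nu> = {1..}" "j \<ge> 1"
  shows "dist_fun \<nu> (j - 1) < dist_fun \<nu> j"
proof -
  obtain m where m: "j = Suc m" using assms(2) by (cases j) auto
  have "dist_fun \<nu> j = dist_fun \<nu> m + pmf \<nu> j"
    unfolding dist_fun_def m by (simp add: measure_measure_pmf_finite)
  moreover have "pmf \<nu> j > 0" using assms by (simp add: pmf_positive)
  ultimately show ?thesis by (simp add: m)
qed

text \<open>Some state i carries mass, and every state reaches \<open>j\<close> in one step because
  \<open>\<nu>\<close> charges all positive integers. The single term for i already bounds
  \<open>pmf \<pi> j\<close> from below.\<close>

lemma lamperti_invariant_pos: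
  assumes "set_pmf \<nu> = {1..}"
    and inv: "invariant_probability (lamperti_matrix (dist_fun \<nu>)) {1..} \<pi>" and j: "j \<ge> 1"
  shows "pmf \<pi> j > 0"
proof -
  let ?P = "lamperti_matrix (dist_fun \<nu>)"
  have P: "?P i j > 0" if "i \<ge> 1" for i
    using that j assms(1) by (intro lamperti_matrix_pos dist_fun_step_less) (auto simp: dist_fun_def)
  obtain i where i: "i \<in> set_pmf \<pi>" using set_pmf_not_empty by fast
  then have i1: "i \<ge> 1" using inv by (auto simp: invariant_probability_def)
  have hs: "((\<lambda>i. pmf \<pi> i * ?P i j) has_sum pmf \<pi> j) {1..}"
    using inv j by (auto simp: invariant_probability_def)
  have "0 < pmf \<pi> i * ?P i j" using i i1 P by (simp add: pmf_positive)
  also have "\<dots> \<le> pmf \<pi> j"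
    by (rule has_sum_mono2[OF has_sum_finite[of "{i}", simplified] hs])
       (use i1 P in \<open>auto simp: less_imp_le\<close>)
  finally show ?thesis .
qed

section \<open>Strict monotonicity of the truncated distribution function and positivity of the
  truncated matrix\<close>

context
  fixes \<pi> :: "nat pmf" and N :: nat
  assumes pi_pos: "\<And>k. 1 \<le> k \<Longrightarrow> k \<le> N \<Longrightarrow> pmf \<pi> k > 0"
begin

lemma trunc_F_spec:
  assumes "1 \<le> j" "j \<le> N"
  shows "0 \<le> trunc_F \<pi> N j"
    and "(\<Sum>k=1..j. trunc_pi \<pi> N k) = (\<Sum>k=1..N. trunc_pi \<pi> N k * trunc_F \<pi> N j ^ k)"
  using theI'[OF trunc_F_ex1[OF pi_pos assms]] assms by (simp_all add: trunc_F_def)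

lemma trunc_F_nonneg: "j \<le> N \<Longrightarrow> 0 \<le> trunc_F \<pi> N j"
  using trunc_F_spec(1)[of j] by (cases "j = 0") (auto simp: trunc_F_def)

lemma trunc_pi_pos: "1 \<le> k \<Longrightarrow> k \<le> N \<Longrightarrow> trunc_pi \<pi> N k > 0"
  unfolding trunc_pi_def by (intro divide_pos_pos sum_pos pi_pos) auto

text \<open>The polynomial defining \<open>trunc_F\<close> is monotone on nonnegative arguments. A
  failure of strict increase would therefore force the partial sum up to \<open>j\<close> below the
  one up to \<open>j - 1\<close>, although \<open>trunc_pi \<pi> N j\<close> is positive.\<close>

lemma trunc_F_step_less:
  assumes "1 \<le> j" "j \<le> N"
  shows "trunc_F \<pi> N (j - 1) < trunc_F \<pi> N j"
proof (rule ccontr)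
  assume "\<not> ?thesis"
  then have le: "trunc_F \<pi> N j \<le> trunc_F \<pi> N (j - 1)" by simp
  \<comment> \<open>For \<open>j = 1\<close> this concerns the default value
    \<open>trunc_F \<pi> N 0 = 0\<close>: the left sum is empty and all powers on the right have
    positive exponent.\<close>
  have eq: "(\<Sum>k=1..j - 1. trunc_pi \<pi> N k) = (\<Sum>k=1..N. trunc_pi \<pi> N k * trunc_F \<pi> N (j - 1) ^ k)"
    using trunc_F_spec(2)[of "j - 1"] assms by (cases "j = 1") (auto simp: trunc_F_def power_0_left)
  have "(\<Sum>k=1..j. trunc_pi \<pi> N k) \<le> (\<Sum>k=1..j - 1. trunc_pi \<pi> N k)"
    unfolding eq trunc_F_spec(2)[OF assms]
    using le assms trunc_F_nonneg trunc_pi_pos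
    by (intro sum_mono mult_left_mono power_mono) (auto simp: less_imp_le)
  moreover have "(\<Sum>k=1..j. trunc_pi \<pi> N k) = (\<Sum>k=1..j - 1. trunc_pi \<pi> N k) + trunc_pi \<pi> N j"
    using assms by (cases j) auto
  ultimately show False using trunc_pi_pos[OF assms] by simp
qed

lemma trunc_matrix_pos:
  assumes "i \<ge> 1" "1 \<le> j" "j \<le> N"
  shows "trunc_matrix \<pi> N i j > 0"
  unfolding trunc_matrix_def using assms
  by (intro lamperti_matrix_pos trunc_F_nonneg trunc_F_step_less) auto

end

section \<open>The eigenvalue belonging to the quasi-stationary distribution\<close>

lemma quasi_stationary_eigen:
  assumes qs: "quasi_stationary \<pi> N \<mu>"
  obtains r where "\<And>j. j \<in> {1..N - 1} \<Longrightarrow>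
    (\<Sum>i=1..N - 1. pmf \<mu> i * trunc_matrix \<pi> N i j) = r * pmf \<mu> j"
proof -
  let ?A = "substoch_mat \<pi> N" and ?v = "Matrix.vec (N - 1) (\<lambda>j. pmf \<mu> (Suc j))"
  let ?r = "spectral_radius (map_mat complex_of_real ?A)"
  have dim: "dim_row ?A = N - 1" "dim_col ?A = N - 1"
    by (auto simp: substoch_mat_def trunc_mat_def)
  \<comment> \<open>Deleting the last row and column shifts no remaining index, so the only offset
    is the one between matrix indices and states.\<close>
  have ent: "?A $$ (i, j) = trunc_matrix \<pi> N (Suc i) (Suc j)" if "i < N - 1" "j < N - 1" for i j
    using that by (simp add: substoch_mat_def trunc_mat_def mat_delete_def)
  have mv: "transpose_mat ?A *\<^sub>v ?v = ?r \<cdot>\<^sub>v ?v"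
    using qs unfolding quasi_stationary_def eigenvector_def by blast
  show thesis
  proof (rule that[of ?r])
    fix j assume "j \<in> {1..N - 1}"
    then obtain m where m: "j = Suc m" "m < N - 1" by (cases j) auto
    have "(\<Sum>i=1..N - 1. pmf \<mu> i * trunc_matrix \<pi> N i j)
        = (\<Sum>i<N - 1. pmf \<mu> (Suc i) * trunc_matrix \<pi> N (Suc i) j)"
      by (simp add: sum.atLeast1_atMost_eq)
    also have "\<dots> = (transpose_mat ?A *\<^sub>v ?v) $ m"
      using m dim ent by (simp add: scalar_prod_def atLeast0LessThan mult.commute)
    also have "\<dots> = ?r * pmf \<mu> j"
      unfolding mv using m by simp
    finally show "(\<Sum>i=1..N - 1. pmf \<mu> i * trunc_matrix \<pi> N i j) = ?r * pmf \<mu> j" .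
  qed
qed

text \<open>As \<open>\<mu>\<close> has total mass 1, summing the eigenvector equation over all
  states isolates the eigenvalue. Exchanging the sums shows it to be the
  \<open>\<mu>\<close>-average of the row sums, that is, the one-step survival probability started
  from \<open>\<mu>\<close>.\<close>

lemma rho_left_eigenvalue:
  assumes qs: "quasi_stationary \<pi> N \<mu>" and j: "j \<in> {1..N - 1}"
  shows "(\<Sum>i=1..N - 1. pmf \<mu> i * trunc_matrix \<pi> N i j) = rho \<pi> N \<mu> * pmf \<mu> j"
proof -
  obtain r where r: "\<And>j. j \<in> {1..N - 1} \<Longrightarrow>
    (\<Sum>i=1..N - 1. pmf \<mu> i * trunc_matrix \<pi> N i j) = r * pmf \<mu> j"
    using quasi_stationary_eigen[OF qs] by blast
  have "r = r * (\<Sum>j=1..N - 1. pmf \<mu> j)"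
    using qs by (subst sum_pmf_eq_1) (auto simp: quasi_stationary_def)
  also have "\<dots> = (\<Sum>j=1..N - 1. \<Sum>i=1..N - 1. pmf \<mu> i * trunc_matrix \<pi> N i j)"
    unfolding sum_distrib_left by (intro sum.cong refl r[symmetric])
  also have "\<dots> = (\<Sum>i=1..N - 1. pmf \<mu> i * (\<Sum>j=1..N - 1. trunc_matrix \<pi> N i j))"
    by (subst sum.swap) (simp add: sum_distrib_left)
  also have "\<dots> = (\<Sum>i=1..N - 1. pmf \<mu> i * trunc_F \<pi> N (N - 1) ^ i)"
    unfolding trunc_matrix_def
    by (intro sum.cong refl, subst sum_lamperti_matrix) (auto simp: trunc_F_def)
  also have "\<dots> = rho \<pi> N \<mu>"
  proof -
    have "{1..N - 1} = {1..<N}" by auto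
    then show ?thesis by (simp add: rho_def mult.commute)
  qed
  finally show ?thesis using r[OF j] by simp
qed

lemma expectation_eq_rho:
  assumes "set_pmf \<mu> = {1..N - 1}" "Z \<in> W \<rightarrow>\<^sub>M count_space UNIV"
    and "distr W (count_space UNIV) Z = measure_pmf \<mu>"
  shows "(\<integral>\<omega>. trunc_F \<pi> N (N - 1) ^ Z \<omega> \<partial>W) = rho \<pi> N \<mu>"
proof -
  have "(\<integral>\<omega>. trunc_F \<pi> N (N - 1) ^ Z \<omega> \<partial>W) = (\<integral>k. trunc_F \<pi> N (N - 1) ^ k \<partial>measure_pmf \<mu>)"
    unfolding assms(3)[symmetric] using assms(2) by (subst integral_distr) auto
  also have "\<dots> = rho \<pi> N \<mu>"
    unfolding rho_def using assms(1)
    by (subst integral_measure_pmf_real[of "{1..<N}"]) auto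
  finally show ?thesis .
qed

theorem proposition14:
  fixes \<nu> \<pi> \<mu> :: "nat pmf" and N i :: nat
    and M :: "'a measure" and X :: "nat \<Rightarrow> 'a \<Rightarrow> nat"
    and W :: "'b measure" and Z :: "'b \<Rightarrow> nat"
  assumes "set_pmf \<nu> = {1..}"
    and "positive_recurrent (lamperti_matrix (dist_fun \<nu>)) {1..}"
    and "invariant_probability (lamperti_matrix (dist_fun \<nu>)) {1..} \<pi>"
    and "N \<ge> 2"
    and "quasi_stationary \<pi> N \<mu>"
    and "prob_space W"
    and "Z \<in> W \<rightarrow>\<^sub>M count_space UNIV"
    and "distr W (count_space UNIV) Z = measure_pmf \<mu>"
    and "i \<in> {1..N - 1}"
    and "markov_chain M {1..N} (trunc_matrix \<pi> N) X"
    and "AE \<omega> in M. X 0 \<omega> = i"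
  shows "prob_space.expectation W (\<lambda>\<omega>. trunc_F \<pi> N (N - 1) ^ Z \<omega>) = rho \<pi> N \<mu> \<and>
    0 < rho \<pi> N \<mu> \<and>
    (\<forall>n. 0 < survival_prob M X N n) \<and>
    (\<lambda>n. - (1 / real n) * ln (survival_prob M X N n))
      \<longlonglongrightarrow> - ln (prob_space.expectation W (\<lambda>\<omega>. trunc_F \<pi> N (N - 1) ^ Z \<omega>)) \<and>
    (\<lambda>n. - (1 / real n) * ln (survival_prob M X N n)) \<longlonglongrightarrow> - ln (rho \<pi> N \<mu>) \<and>
    (\<lambda>n. root n (survival_prob M X N n)) \<longlonglongrightarrow> rho \<pi> N \<mu>"
proof -
  let ?P = "trunc_matrix \<pi> N" and ?T = "{1..N - 1}" and ?r = "rho \<pi> N \<mu>"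
  have pi: "pmf \<pi> k > 0" if "1 \<le> k" for k
    by (rule lamperti_invariant_pos[OF assms(1,3) that])
  have P: "?P k j > 0" if "k \<in> ?T" "j \<in> ?T" for k j
    using that by (intro trunc_matrix_pos pi) auto
  have mu: "pmf \<mu> j > 0" if "j \<in> ?T" for j
    using assms(5) that by (simp add: quasi_stationary_def pmf_positive)
  note eig = rho_left_eigenvalue[OF assms(5)]
  \<comment> \<open>Read at state \<open>i\<close>, the eigenvector equation has a positive left
    side and a positive factor \<open>pmf \<mu> i\<close> on the right, which forces the eigenvalue
    to be positive.\<close>
  have "0 < (\<Sum>k=1..N - 1. pmf \<mu> k * ?P k i)"
    using assms(9) P mu by (intro sum_pos mult_pos_pos) auto
  then have r: "?r > 0"
    using eig[OF assms(9)] mu[OF assms(9)] by (simp add: zero_less_mult_iff)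
  have "{1..N} - {N} = ?T" using assms(4) by auto
  then have surv: "survival_prob M X N n = avoid_prob ?P ?T n i" for n
    using survival_prob_eq[OF assms(10) _ assms(11), of N n] by simp
  have pos: "survival_prob M X N n > 0" for n
    unfolding surv by (rule avoid_prob_pos) (use P assms(9) in auto)
  \<comment> \<open>The starting state affects only the constants \<open>a\<close> and
    \<open>b\<close>; the ratio \<open>?r\<close> does not involve \<open>i\<close>, hence neither
    does the limit.\<close>
  obtain a b where "a > 0" "b > 0"
    "\<And>n. a * ?r ^ n \<le> survival_prob M X N n" "\<And>n. survival_prob M X N n \<le> b * ?r ^ n"
    unfolding surv
    by (rule avoid_prob_geometric[of ?T ?P "pmf \<mu>" ?r i]) (use P eig mu r assms(9) in auto)
  note rate = geometric_decay_rate[OF this(1,2) r this(3,4)]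
  have "(\<lambda>n. - (1 / real n) * ln (survival_prob M X N n)) \<longlonglongrightarrow> - ln ?r"
    using tendsto_minus[OF rate] by simp
  moreover have "(\<integral>\<omega>. trunc_F \<pi> N (N - 1) ^ Z \<omega> \<partial>W) = ?r"
    using assms(5,7,8) by (intro expectation_eq_rho) (auto simp: quasi_stationary_def)
  ultimately show ?thesis
    using r pos root_decay_rate[OF pos r rate] by simp
qed

end
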